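(* Let $\mathcal{Z}\subset\mathbb{R}^d$ be nonempty, closed and convex, and let $F:\mathcal{Z}\to\mathbb{R}^d$ be a monotone operator that is locally Lipschitz continuous on $\mathcal{Z}$. Let $z_0\in\mathcal{Z}$, $\eta_0>0$, $\theta\in(0,1)$, $\rho\in(0,1)$, and let $(\lambda_t)_{t\ge0}$ satisfy $\lambda_t\ge1$ for all $t$ and $\lim_{t\to\infty}\lambda_t=1$. Run the PF-NE-EG algorithm with non-monotone backtracking line search described in the context. Then at each iteration the backtracking procedure (step (2)) stops within finitely many operations. Thus $\eta_t>0$ holds for all $t$ until termination.
   Context: $F$ is monotone if $\langle F(z)-F(w),z-w\rangle\ge0$ for all $z,w\in\mathcal{Z}$. $F$ is locally Lipschitz on $\mathcal{Z}$ if for every $z\in\mathcal{Z}$ there are $L(z)>0$ and a (relative) neighborhood $N(z)\subset\mathcal{Z}$ of $z$ with $\|F(z')-F(z'')\|_2\le L(z)\|z'-z''\|_2$ for all $z',z''\in N(z)$. $\mathrm{Proj}_{\mathcal{Z}}$ is the Euclidean projection onto $\mathcal{Z}$. Extragradient update with stepsize $\eta_t>0$: $w_t=\mathrm{Proj}_{\mathcal{Z}}(z_t-\eta_tF(z_t))$, $z_{t+1}=\mathrm{Proj}_{\mathcal{Z}}(z_t-\eta_tF(w_t))$. Local Lipschitz estimates: $L_t=\|F(w_t)-F(z_t)\|_2/\|w_t-z_t\|_2$ (defined when $w_t\ne z_t$); $\hat L_t=\|F(w_t)-F(z_{t+1})\|_2/\|w_t-z_{t+1}\|_2$ if $w_t\ne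 z_{t+1}$, and $\hat L_t=0$ if $w_t=z_{t+1}$. PF-NE-EG algorithm with non-monotone backtracking line search: compute $w_0,z_1$ by the extragradient update from $z_0$ with stepsize $\eta_0$ (stop and return $z_0$ if $w_0=z_0$). For $t=1,2,\dots$: (1) Set $\bar\eta_t=\min\{\lambda_{t-1}\eta_{t-1},\ \theta/L_{t-1},\ \theta/\hat L_{t-1}\}$, where $\theta/0$ is read as $+\infty$. (2) For $\eta>0$ let $w_t(\eta)=\mathrm{Proj}_{\mathcal{Z}}(z_t-\eta F(z_t))$ and $z_{t+1}(\eta)=\mathrm{Proj}_{\mathcal{Z}}(z_t-\eta F(w_t(\eta)))$. Starting with $\eta=\bar\eta_t$, repeatedly replace $\eta$ by $\rho\eta$ until both $\eta\,\|F(w_t(\eta))-F(z_t)\|_2/\|w_t(\eta)-z_t\|_2\le\frac{\theta+1}{2}$ and, if $w_t(\eta)\ne z_{t+1}(\eta)$, $\eta\,\|F(w_t(\eta))-F(z_{t+1}(\eta))\|_2/\|w_t(\eta)-z_{t+1}(\eta)\|_2\le1$ hold; if $w_t(\eta)=z_t$ is encountered, stop and return $z_t$ (which is then a solution of the variational inequality). Set $\eta_t=\eta$. (3) Compute $w_t,z_{t+1}$ by the extragradient update with stepsize $\eta_t$. *)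

theory Defs
  imports "HOL-Analysis.Analysis" "HOL-Library.While_Combinator"
begin

definition monotone_operator_on :: "'a::euclidean_space set \<Rightarrow> ('a \<Rightarrow> 'a) \<Rightarrow> bool" where
  "monotone_operator_on Z F \<longleftrightarrow> (\<forall>z\<in>Z. \<forall>w\<in>Z. (F z - F w) \<bullet> (z - w) \<ge> 0)"

definition locally_lipschitz_on :: "'a::euclidean_space set \<Rightarrow> ('a \<Rightarrow> 'a) \<Rightarrow> bool" where
  "locally_lipschitz_on Z F \<longleftrightarrow>
     (\<forall>z\<in>Z. \<exists>L>0. \<exists>N. openin (top_of_set Z) N \<and> z \<in> N \<and> L-lipschitz_on N F)"

definition eg_mid :: "'a::euclidean_space set \<Rightarrow> ('a \<Rightarrow> 'a) \<Rightarrow> 'a \<Rightarrow> real \<Rightarrow> 'a" where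
  "eg_mid Z F z \<eta> = closest_point Z (z - \<eta> *\<^sub>R F z)"

definition eg_next :: "'a::euclidean_space set \<Rightarrow> ('a \<Rightarrow> 'a) \<Rightarrow> 'a \<Rightarrow> real \<Rightarrow> 'a" where
  "eg_next Z F z \<eta> = closest_point Z (z - \<eta> *\<^sub>R F (eg_mid Z F z \<eta>))"

definition lip_est :: "('a::euclidean_space \<Rightarrow> 'a) \<Rightarrow> 'a \<Rightarrow> 'a \<Rightarrow> real" where
  "lip_est F x y = norm (F x - F y) / norm (x - y)"

definition lip_est0 :: "('a::euclidean_space \<Rightarrow> 'a) \<Rightarrow> 'a \<Rightarrow> 'a \<Rightarrow> real" where
  "lip_est0 F x y = (if x \<noteq> y then lip_est F x y else 0)"

text \<open>The first trial stepsize of an iteration, from the factor \<open>l\<close> and the data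
  \<open>z\<close>, \<open>w\<close>, \<open>z'\<close>, \<open>\<eta>\<close> (current point, midpoint, next point, stepsize) of the
  preceding iteration.  The minimum is taken in the extended reals, where \<open>\<theta> / 0 = \<infinity>\<close>
  for \<open>\<theta> > 0\<close>, whereas real division would give 0.\<close>

definition trial_stepsize ::
  "('a::euclidean_space \<Rightarrow> 'a) \<Rightarrow> real \<Rightarrow> real \<Rightarrow> 'a \<Rightarrow> 'a \<Rightarrow> 'a \<Rightarrow> real \<Rightarrow> real" where
  "trial_stepsize F \<theta> l z w z' \<eta> =
     real_of_ereal (min (ereal (l * \<eta>))
       (min (ereal \<theta> / ereal (lip_est F w z)) (ereal \<theta> / ereal (lip_est0 F w z'))))"

definition acceptable ::
  "'a::euclidean_space set \<Rightarrow> ('a \<Rightarrow> 'a) \<Rightarrow> real \<Rightarrow> 'a \<Rightarrow> real \<Rightarrow> bool" where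
  "acceptable Z F \<theta> z \<eta> \<longleftrightarrow>
     (let w = eg_mid Z F z \<eta>; z' = eg_next Z F z \<eta> in
        \<eta> * lip_est F w z \<le> (\<theta> + 1) / 2 \<and>
        (w \<noteq> z' \<longrightarrow> \<eta> * lip_est F w z' \<le> 1))"

text \<open>The loop is left at the first stepsize that either satisfies \<open>eg_mid Z F z \<eta> = z\<close>
  (the algorithm then returns \<open>z\<close>) or is acceptable.  The result is \<open>None\<close> iff the loop
  does not terminate.\<close>

definition line_search ::
  "'a::euclidean_space set \<Rightarrow> ('a \<Rightarrow> 'a) \<Rightarrow> real \<Rightarrow> real \<Rightarrow> 'a \<Rightarrow> real \<Rightarrow> real option" where
  "line_search Z F \<theta> \<rho> z \<eta> =
     while_option (\<lambda>\<eta>. eg_mid Z F z \<eta> \<noteq> z \<and> \<not> acceptable Z F \<theta> z \<eta>) (\<lambda>\<eta>. \<rho> * \<eta>) \<eta>"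

text \<open>\<open>Running z w z' \<eta>\<close> after iteration \<open>t\<close> holds \<open>z\<^sub>t\<close>, \<open>w\<^sub>t\<close>, \<open>z\<^sub>t\<^sub>+\<^sub>1\<close>, \<open>\<eta>\<^sub>t\<close>, with
  \<open>w\<^sub>t \<noteq> z\<^sub>t\<close>, so that the estimate \<open>lip_est F w z\<close> is meaningful.  \<open>Diverged\<close> means that
  some line search did not terminate.\<close>

datatype 'a config = Running 'a 'a 'a real | Returned 'a | Diverged

definition extragradient_step ::
  "'a::euclidean_space set \<Rightarrow> ('a \<Rightarrow> 'a) \<Rightarrow> 'a \<Rightarrow> real \<Rightarrow> 'a config" where
  "extragradient_step Z F z \<eta> =
     (if eg_mid Z F z \<eta> = z then Returned z
      else Running z (eg_mid Z F z \<eta>) (eg_next Z F z \<eta>) \<eta>)"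

primrec pf_ne_eg ::
  "'a::euclidean_space set \<Rightarrow> ('a \<Rightarrow> 'a) \<Rightarrow> real \<Rightarrow> real \<Rightarrow> (nat \<Rightarrow> real) \<Rightarrow> 'a \<Rightarrow> real \<Rightarrow>
     nat \<Rightarrow> 'a config" where
  "pf_ne_eg Z F \<theta> \<rho> lam z0 \<eta>0 0 = extragradient_step Z F z0 \<eta>0"
| "pf_ne_eg Z F \<theta> \<rho> lam z0 \<eta>0 (Suc t) =
     (case pf_ne_eg Z F \<theta> \<rho> lam z0 \<eta>0 t of
        Running z w z' \<eta> \<Rightarrow>
          (case line_search Z F \<theta> \<rho> z' (trial_stepsize F \<theta> (lam t) z w z' \<eta>) of
             None \<Rightarrow> Diverged
           | Some \<eta>' \<Rightarrow> extragradient_step Z F z' \<eta>')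
      | Returned x \<Rightarrow> Returned x
      | Diverged \<Rightarrow> Diverged)"

end

theory Submission
  imports Defs
begin

text \<open>Projection onto \<open>Z\<close> is nonexpansive, so both trial points of an extragradient step from
  \<open>z \<in> Z\<close> tend to \<open>z\<close> as the stepsize tends to \<open>0\<close>.  Once they lie in a neighbourhood of \<open>z\<close>
  on which \<open>F\<close> is \<open>L\<close>-Lipschitz, every stepsize below \<open>1 / (2 * L)\<close> is acceptable,
  and geometric backtracking from a positive stepsize reaches this range.\<close>

lemma dist_closest_point_diff_scaleR_le:
  fixes z v :: "'a::euclidean_space"
  assumes "closed Z" "convex Z" "z \<in> Z" "0 \<le> \<eta>"
  shows "dist (closest_point Z (z - \<eta> *\<^sub>R v)) z \<le> \<eta> * norm v"
proof -
  have "dist (closest_point Z (z - \<eta> *\<^sub>R v)) (closest_point Z z) \<le> dist (z - \<eta> *\<^sub>R v) z"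
    using assms by (intro closest_point_lipschitz) auto
  then show ?thesis
    using assms by (simp add: closest_point_self dist_norm)
qed

lemma lip_est_le:
  assumes "L-lipschitz_on N F" "x \<in> N" "y \<in> N"
  shows "lip_est F x y \<le> L"
proof (cases "x = y")
  \<comment> \<open>Division by zero gives \<open>lip_est F x x = 0\<close>, and a Lipschitz
    constant is nonnegative.\<close>
  case True
  then show ?thesis
    using lipschitz_on_nonneg[OF assms(1)] by (simp add: lip_est_def)
next
  case False
  then show ?thesis
    using lipschitz_onD[OF assms] by (simp add: lip_est_def dist_norm divide_le_eq)
qed

lemma eventually_acceptable:
  fixes F :: "'a::euclidean_space \<Rightarrow> 'a"
  assumes Z: "closed Z" "convex Z" "z \<in> Z" and F: "locally_lipschitz_on Z F" and \<theta>: "0 \<le> \<theta>"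
  shows "eventually (acceptable Z F \<theta> z) (at_right 0)"
proof -
  obtain L N where "L > 0" and N: "openin (top_of_set Z) N" "z \<in> N" and L: "L-lipschitz_on N F"
    using F \<open>z \<in> Z\<close> unfolding locally_lipschitz_on_def by blast
  obtain e where "e > 0" and e: "\<And>x. x \<in> Z \<Longrightarrow> dist x z < e \<Longrightarrow> x \<in> N"
    using N unfolding openin_euclidean_subtopology_iff by blast
  \<comment> \<open>Chosen to bound \<open>norm (F x)\<close> at \<open>z\<close> and at every point
    of \<open>N\<close> within distance \<open>e\<close> of \<open>z\<close>, hence at the midpoint
    too; one condition on \<open>\<eta>\<close> then controls both projections.\<close>
  define M where "M = norm (F z) + L * e"
  have "M > 0"
    using \<open>L > 0\<close> \<open>e > 0\<close> by (simp add: M_def add_nonneg_pos)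
  have cp: "closest_point Z x \<in> Z" for x
    using Z closest_point_in_set by blast
  have acc: "acceptable Z F \<theta> z \<eta>" if "0 < \<eta>" "\<eta> < e / M" "\<eta> < 1 / (2 * L)" for \<eta>
  proof -
    have \<eta>: "\<eta> * M < e" "\<eta> * L < 1 / 2"
      using that \<open>M > 0\<close> \<open>L > 0\<close> by (simp_all add: field_simps)
    have near: "closest_point Z (z - \<eta> *\<^sub>R v) \<in> N" if "norm v \<le> M" for v
    proof (rule e[OF cp])
      have "dist (closest_point Z (z - \<eta> *\<^sub>R v)) z \<le> \<eta> * norm v"
        using Z \<open>0 < \<eta>\<close> by (intro dist_closest_point_diff_scaleR_le) auto
      also have "\<dots> \<le> \<eta> * M"
        using that \<open>0 < \<eta>\<close> by simp
      finally show "dist (closest_point Z (z - \<eta> *\<^sub>R v)) z < e"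
        using \<eta> by simp
    qed
    have wN: "eg_mid Z F z \<eta> \<in> N"
      unfolding eg_mid_def using \<open>L > 0\<close> \<open>e > 0\<close> by (intro near) (simp add: M_def)
    \<comment> \<open>Membership in \<open>N\<close> alone does not bound the distance to
      \<open>z\<close>; this explicit estimate yields \<open>norm (F w) \<le> M\<close> at the
      midpoint \<open>w\<close>, so that \<open>near\<close> applies a second time.\<close>
    have "dist (eg_mid Z F z \<eta>) z \<le> \<eta> * norm (F z)"
      unfolding eg_mid_def using Z that by (intro dist_closest_point_diff_scaleR_le) auto
    also have "\<dots> \<le> \<eta> * M"
      using that \<open>L > 0\<close> \<open>e > 0\<close> by (simp add: M_def)
    finally have "dist (eg_mid Z F z \<eta>) z \<le> e"
      using \<eta> by simp
    then have "L * dist (eg_mid Z F z \<eta>) z \<le> L * e"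
      using \<open>L > 0\<close> by simp
    then have "norm (F (eg_mid Z F z \<eta>) - F z) \<le> L * e"
      using lipschitz_onD[OF L wN \<open>z \<in> N\<close>] by (simp add: dist_norm)
    then have "norm (F (eg_mid Z F z \<eta>)) \<le> M"
      using norm_triangle_sub[of "F (eg_mid Z F z \<eta>)" "F z"] by (simp add: M_def)
    then have nN: "eg_next Z F z \<eta> \<in> N"
      unfolding eg_next_def by (rule near)
    \<comment> \<open>Taking \<open>y\<close> to be \<open>z\<close> and then the next point settles
      both tests, since \<open>0 \<le> \<theta>\<close> gives
      \<open>1 / 2 \<le> (\<theta> + 1) / 2\<close>.\<close>
    have "\<eta> * lip_est F (eg_mid Z F z \<eta>) y \<le> 1 / 2" if "y \<in> N" for y
      using mult_left_mono[OF lip_est_le[OF L wN that], of \<eta>] \<eta> \<open>0 < \<eta>\<close> by linarith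
    from this[OF \<open>z \<in> N\<close>] this[OF nN] show ?thesis
      using \<theta> by (simp add: acceptable_def Let_def)
  qed
  have "0 < min (e / M) (1 / (2 * L))"
    using \<open>e > 0\<close> \<open>M > 0\<close> \<open>L > 0\<close> by simp
  then show ?thesis
    unfolding eventually_at_right_field using acc by (metis min_less_iff_conj)
qed

lemma line_search_terminates:
  fixes F :: "'a::euclidean_space \<Rightarrow> 'a"
  assumes "closed Z" "convex Z" "z \<in> Z" "locally_lipschitz_on Z F" "0 \<le> \<theta>"
    and \<rho>: "0 < \<rho>" "\<rho> < 1" and "0 < \<eta>"
  shows "line_search Z F \<theta> \<rho> z \<eta> \<noteq> None"
proof -
  have "(\<lambda>k. \<rho> ^ k * \<eta>) \<longlonglongrightarrow> 0"
    using \<rho> by (intro tendsto_mult_left_zero LIMSEQ_power_zero) auto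
  \<comment> \<open>The trial stepsizes stay positive, so they approach 0 from the right, where
    acceptability holds eventually.\<close>
  then have "filterlim (\<lambda>k. \<rho> ^ k * \<eta>) (at_right 0) sequentially"
    using \<rho> \<open>0 < \<eta>\<close> by (intro tendsto_imp_filterlim_at_right) auto
  then have "eventually (\<lambda>k. acceptable Z F \<theta> z (\<rho> ^ k * \<eta>)) sequentially"
    using eventually_acceptable[OF assms(1-5)] by (simp add: filterlim_iff)
  then obtain k where "acceptable Z F \<theta> z (\<rho> ^ k * \<eta>)"
    by (auto simp: eventually_sequentially)
  moreover have "((\<lambda>\<eta>. \<rho> * \<eta>) ^^ k) \<eta> = \<rho> ^ k * \<eta>" for k
    by (induction k) auto
  \<comment> \<open>\<open>while_option\<close> yields \<open>None\<close> only if the loop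
    condition holds at every iterate; one acceptable iterate refutes this.\<close>
  ultimately show ?thesis
    unfolding line_search_def while_option_def by auto
qed

text \<open>Positivity is a loop invariant, because each pass multiplies by
  \<open>\<rho> > 0\<close>.\<close>

lemma line_search_pos:
  assumes "line_search Z F \<theta> \<rho> z \<eta> = Some \<eta>'" "0 < \<rho>" "0 < \<eta>"
  shows "0 < \<eta>'"
  using while_option_rule[where P = "\<lambda>\<eta>. 0 < \<eta>", OF _ assms(1)[unfolded line_search_def]]
    assms(2,3) by simp

lemma trial_stepsize_pos:
  assumes "0 < \<theta>" "0 < l" "0 < \<eta>"
  shows "0 < trial_stepsize F \<theta> l z w z' \<eta>"
proof -
  have pos: "0 < ereal \<theta> / ereal x" if "0 \<le> x" for x
    using that \<open>0 < \<theta>\<close> by (cases "x = 0") auto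
  define m where "m = min (ereal \<theta> / ereal (lip_est F w z)) (ereal \<theta> / ereal (lip_est0 F w z'))"
  have "0 < min (ereal (l * \<eta>)) m"
    using assms pos by (simp add: m_def lip_est_def lip_est0_def)
  \<comment> \<open>Both quotients may be infinite, and \<open>real_of_ereal\<close> maps infinity
    to 0; the finite bound \<open>l * \<eta>\<close> excludes this for the minimum.\<close>
  moreover have "min (ereal (l * \<eta>)) m \<le> ereal (l * \<eta>)"
    by simp
  ultimately have "0 < real_of_ereal (min (ereal (l * \<eta>)) m)"
    by (cases "min (ereal (l * \<eta>)) m") auto
  then show ?thesis
    by (simp add: trial_stepsize_def m_def)
qed

lemma extragradient_step_eq_Running:
  assumes "extragradient_step Z F z \<eta> = Running x w x' \<eta>'" "closed Z" "Z \<noteq> {}"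
  shows "x' \<in> Z \<and> \<eta>' = \<eta>"
  using assms closest_point_in_set
  by (auto simp: extragradient_step_def eg_next_def split: if_splits)

text \<open>The invariant that makes the next line search start at a point of \<open>Z\<close> with
  a positive trial stepsize. No termination result enters: a \<open>Running\<close> successor
  already presupposes that the search returned \<open>Some\<close>.\<close>

lemma pf_ne_eg_eq_Running:
  assumes "closed Z" "Z \<noteq> {}" "0 < \<eta>0" "0 < \<theta>" "0 < \<rho>" "\<And>t. 0 < lam t"
    and "pf_ne_eg Z F \<theta> \<rho> lam z0 \<eta>0 t = Running z w z' \<eta>"
  shows "z' \<in> Z \<and> 0 < \<eta>"
  using assms(7)
proof (induction t arbitrary: z w z' \<eta>)
  case 0
  then show ?case
    using extragradient_step_eq_Running[of Z F z0 \<eta>0] assms by fastforce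
next
  case (Suc t)
  obtain x v x' \<mu> \<mu>' where prev: "pf_ne_eg Z F \<theta> \<rho> lam z0 \<eta>0 t = Running x v x' \<mu>"
    and ls: "line_search Z F \<theta> \<rho> x' (trial_stepsize F \<theta> (lam t) x v x' \<mu>) = Some \<mu>'"
    and step: "extragradient_step Z F x' \<mu>' = Running z w z' \<eta>"
    using Suc.prems by (auto split: config.splits option.splits)
  have "0 < \<mu>'"
    using line_search_pos[OF ls \<open>0 < \<rho>\<close>] trial_stepsize_pos Suc.IH[OF prev] assms by blast
  then show ?case
    using extragradient_step_eq_Running[OF step] assms by simp
qed

theorem lemma7:
  fixes Z :: "(real ^ 'd) set" and F :: "real ^ 'd \<Rightarrow> real ^ 'd"
    and z0 :: "real ^ 'd" and \<eta>0 \<theta> \<rho> :: real and lam :: "nat \<Rightarrow> real"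
  assumes "Z \<noteq> {}" "closed Z" "convex Z"
    and "monotone_operator_on Z F"
    and "locally_lipschitz_on Z F"
    and "z0 \<in> Z" and "\<eta>0 > 0"
    and "0 < \<theta>" "\<theta> < 1" and "0 < \<rho>" "\<rho> < 1"
    and "\<And>t. lam t \<ge> 1" and "lam \<longlonglongrightarrow> 1"
  shows "(\<forall>t z w z' \<eta>. pf_ne_eg Z F \<theta> \<rho> lam z0 \<eta>0 t = Running z w z' \<eta> \<longrightarrow>
            line_search Z F \<theta> \<rho> z' (trial_stepsize F \<theta> (lam t) z w z' \<eta>) \<noteq> None) \<and>
         (\<forall>t z w z' \<eta>. pf_ne_eg Z F \<theta> \<rho> lam z0 \<eta>0 t = Running z w z' \<eta> \<longrightarrow> \<eta> > 0)"
proof -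
  have lam: "0 < lam t" for t
    using assms(12)[of t] by simp
  have run: "z' \<in> Z \<and> 0 < \<eta>"
    if "pf_ne_eg Z F \<theta> \<rho> lam z0 \<eta>0 t = Running z w z' \<eta>" for t z w z' \<eta>
    using pf_ne_eg_eq_Running[OF _ _ _ _ _ lam that] assms by simp
  have "line_search Z F \<theta> \<rho> z' (trial_stepsize F \<theta> (lam t) z w z' \<eta>) \<noteq> None"
    if "pf_ne_eg Z F \<theta> \<rho> lam z0 \<eta>0 t = Running z w z' \<eta>" for t z w z' \<eta>
    using run[OF that] assms lam by (intro line_search_terminates trial_stepsize_pos) auto
  with run show ?thesis
    by blast
qed

end
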